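(* Let $(A,\mu,\alpha,\beta)$ be a regular BiHom-associative algebra. Then $A^+=(A,\mu',\alpha,\beta)$ is a BiHom-Jordan algebra, where $$\mu'(x,y)=\mu(x,y)+\mu(\alpha^{-1}\beta(y),\beta^{-1}\alpha(x))\quad\text{for all }x,y\in A.$$
   Context: $\mathbb{K}$ is an algebraically closed field of characteristic $0$; all vector spaces and (multi)linear maps are over $\mathbb{K}$. A BiHom-algebra $(A,\mu,\alpha,\beta)$ is a vector space $A$ with a bilinear map $\mu:A\times A\to A$ and linear maps $\alpha,\beta:A\to A$ with $\alpha\beta=\beta\alpha$. It is multiplicative if $\alpha(\mu(x,y))=\mu(\alpha(x),\alpha(y))$ and $\beta(\mu(x,y))=\mu(\beta(x),\beta(y))$ for all $x,y\in A$. It is regular if $\alpha$ and $\beta$ are algebra automorphisms. Its BiHom-associator is $as_{\alpha,\beta}(x,y,z)=\mu(\mu(x,y),\beta(z))-\mu(\alpha(x),\mu(y,z))$. A BiHom-associative algebra is a multiplicative BiHom-algebra with $as_{\alpha,\beta}(x,y,z)=0$ for all $x,y,z\in A$. A BiHom-Jordan algebra is a multiplicative BiHom-algebra $(A,\mu,\alpha,\beta)$ such that for all $x,y\in A$: $\mu(\beta(x),\alpha(y))=\mu(\beta(y),\alpha(x))$ and $as_{\alpha,\beta}\big(\mu(\beta^2(x),\alpha\beta(x)),\alpha^2\beta(y),\alpha^3(x)\big)=0$. *)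

theory Defs
  imports "HOL-Computational_Algebra.Polynomial"
begin

definition bilinear_on :: "('k::field \<Rightarrow> 'a::ab_group_add \<Rightarrow> 'a) \<Rightarrow> ('a \<Rightarrow> 'a \<Rightarrow> 'a) \<Rightarrow> bool" where
  "bilinear_on scale \<mu> \<longleftrightarrow>
     (\<forall>y. Vector_Spaces.linear scale scale (\<lambda>x. \<mu> x y)) \<and>
     (\<forall>x. Vector_Spaces.linear scale scale (\<lambda>y. \<mu> x y))"

definition algebra_automorphism ::
    "('k::field \<Rightarrow> 'a::ab_group_add \<Rightarrow> 'a) \<Rightarrow> ('a \<Rightarrow> 'a \<Rightarrow> 'a) \<Rightarrow> ('a \<Rightarrow> 'a) \<Rightarrow> bool" where
  "algebra_automorphism scale \<mu> f \<longleftrightarrow>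
     Vector_Spaces.linear scale scale f \<and> bij f \<and> (\<forall>x y. f (\<mu> x y) = \<mu> (f x) (f y))"

definition bihom_associator ::
    "('a::ab_group_add \<Rightarrow> 'a \<Rightarrow> 'a) \<Rightarrow> ('a \<Rightarrow> 'a) \<Rightarrow> ('a \<Rightarrow> 'a) \<Rightarrow> 'a \<Rightarrow> 'a \<Rightarrow> 'a \<Rightarrow> 'a" where
  "bihom_associator \<mu> \<alpha> \<beta> x y z = \<mu> (\<mu> x y) (\<beta> z) - \<mu> (\<alpha> x) (\<mu> y z)"

text \<open>The underlying vector space is the whole type \<open>'a\<close>, with scalar multiplication \<open>scale\<close>;
  no restriction is placed on its dimension.\<close>

locale bihom_algebra = vector_space scale
  for scale :: "'k::{alg_closed_field, field_char_0} \<Rightarrow> 'a::ab_group_add \<Rightarrow> 'a" +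
  fixes \<mu> :: "'a \<Rightarrow> 'a \<Rightarrow> 'a"
    and \<alpha> :: "'a \<Rightarrow> 'a"
    and \<beta> :: "'a \<Rightarrow> 'a"
  assumes bilinear_mult: "bilinear_on scale \<mu>"
    and linear_alpha: "Vector_Spaces.linear scale scale \<alpha>"
    and linear_beta: "Vector_Spaces.linear scale scale \<beta>"
    and alpha_beta_commute: "\<alpha> \<circ> \<beta> = \<beta> \<circ> \<alpha>"

locale multiplicative_bihom_algebra = bihom_algebra +
  assumes alpha_mult: "\<And>x y. \<alpha> (\<mu> x y) = \<mu> (\<alpha> x) (\<alpha> y)"
    and beta_mult: "\<And>x y. \<beta> (\<mu> x y) = \<mu> (\<beta> x) (\<beta> y)"

locale regular_bihom_algebra = bihom_algebra +
  assumes alpha_automorphism: "algebra_automorphism scale \<mu> \<alpha>"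
    and beta_automorphism: "algebra_automorphism scale \<mu> \<beta>"

locale bihom_associative_algebra = multiplicative_bihom_algebra +
  assumes bihom_associative: "\<And>x y z. bihom_associator \<mu> \<alpha> \<beta> x y z = 0"

locale bihom_jordan_algebra = multiplicative_bihom_algebra +
  assumes bihom_commutative: "\<And>x y. \<mu> (\<beta> x) (\<alpha> y) = \<mu> (\<beta> y) (\<alpha> x)"
    and bihom_jordan_identity:
      "\<And>x y. bihom_associator \<mu> \<alpha> \<beta>
                (\<mu> ((\<beta> ^^ 2) x) (\<alpha> (\<beta> x))) ((\<alpha> ^^ 2) (\<beta> y)) ((\<alpha> ^^ 3) x) = 0"

text \<open>The product of \<open>A\<^sup>+\<close>. The inverses are meaningful only for bijective
  \<open>\<alpha>\<close> and \<open>\<beta>\<close>, that is, for a regular algebra.\<close>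

definition plus_mult ::
    "('a::ab_group_add \<Rightarrow> 'a \<Rightarrow> 'a) \<Rightarrow> ('a \<Rightarrow> 'a) \<Rightarrow> ('a \<Rightarrow> 'a) \<Rightarrow> 'a \<Rightarrow> 'a \<Rightarrow> 'a" where
  "plus_mult \<mu> \<alpha> \<beta> x y = \<mu> x y + \<mu> (inv \<alpha> (\<beta> y)) (inv \<beta> (\<alpha> x))"

end

(* Untwisting: x \<star> y = \<mu> (\<alpha>^-1 x) (\<beta>^-1 y) is an ordinary associative product on which \<alpha> and \<beta>
   still act as automorphisms, and the product of A^+ is the ordinary Jordan product
   \<alpha> x \<star> \<beta> y + \<beta> y \<star> \<alpha> x. Writing u = \<alpha>^3 \<beta>^2 x, the BiHom-Jordan identity becomes the classical
   Jordan identity for u. *)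

theory Submission
  imports Defs
begin

lemma (in vector_space) linear_iff_add_scale:
  "Vector_Spaces.linear scale scale f \<longleftrightarrow>
     (\<forall>x y. f (x + y) = f x + f y) \<and> (\<forall>c x. f (scale c x) = scale c (f x))"
  using vector_space_axioms by (simp add: Vector_Spaces.linear_iff)

text \<open>With brackets removed by associativity, both sides are twice
  \<open>uuuv + uuvu + uvuu + vuuu\<close>.\<close>

lemma jordan_identity_of_associative:
  fixes m :: "'a::ab_group_add \<Rightarrow> 'a \<Rightarrow> 'a"
  assumes add_left: "\<And>a b c. m (a + b) c = m a c + m b c"
    and add_right: "\<And>a b c. m a (b + c) = m a b + m a c"
    and assoc: "\<And>a b c. m (m a b) c = m a (m b c)"
    and j: "\<And>a b. j a b = m a b + m b a"
  shows "j (j (j u u) v) u = j (j u u) (j v u)"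
  by (simp add: j add_left add_right assoc add_ac)

locale regular_bihom_associative_algebra = bihom_associative_algebra + regular_bihom_algebra
begin

lemma alpha_add: "\<alpha> (x + y) = \<alpha> x + \<alpha> y"
  and alpha_scale: "\<alpha> (scale c x) = scale c (\<alpha> x)"
  using linear_alpha by (simp_all add: linear_iff_add_scale)

lemma beta_add: "\<beta> (x + y) = \<beta> x + \<beta> y"
  and beta_scale: "\<beta> (scale c x) = scale c (\<beta> x)"
  using linear_beta by (simp_all add: linear_iff_add_scale)

lemma mult_add_left: "\<mu> (x + y) z = \<mu> x z + \<mu> y z"
  and mult_add_right: "\<mu> z (x + y) = \<mu> z x + \<mu> z y"
  and mult_scale_left: "\<mu> (scale c x) z = scale c (\<mu> x z)"
  and mult_scale_right: "\<mu> z (scale c x) = scale c (\<mu> z x)"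
  using bilinear_mult by (simp_all add: bilinear_on_def linear_iff_add_scale)

lemma alpha_beta: "\<alpha> (\<beta> x) = \<beta> (\<alpha> x)"
  using alpha_beta_commute by (metis comp_apply)

lemma bij_alpha: "bij \<alpha>" and bij_beta: "bij \<beta>"
  using alpha_automorphism beta_automorphism by (simp_all add: algebra_automorphism_def)

lemma inv_alpha_alpha [simp]: "inv \<alpha> (\<alpha> x) = x"
  and alpha_inv_alpha [simp]: "\<alpha> (inv \<alpha> x) = x"
  using bij_alpha by (simp_all add: bij_is_inj bij_is_surj surj_f_inv_f)

lemma inv_beta_beta [simp]: "inv \<beta> (\<beta> x) = x"
  and beta_inv_beta [simp]: "\<beta> (inv \<beta> x) = x"
  using bij_beta by (simp_all add: bij_is_inj bij_is_surj surj_f_inv_f)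

lemma inv_alpha_add: "inv \<alpha> (x + y) = inv \<alpha> x + inv \<alpha> y"
  by (metis alpha_add alpha_inv_alpha inv_alpha_alpha)

lemma inv_alpha_scale: "inv \<alpha> (scale c x) = scale c (inv \<alpha> x)"
  by (metis alpha_scale alpha_inv_alpha inv_alpha_alpha)

lemma inv_beta_add: "inv \<beta> (x + y) = inv \<beta> x + inv \<beta> y"
  by (metis beta_add beta_inv_beta inv_beta_beta)

lemma inv_beta_scale: "inv \<beta> (scale c x) = scale c (inv \<beta> x)"
  by (metis beta_scale beta_inv_beta inv_beta_beta)

lemma inv_alpha_beta: "inv \<alpha> (\<beta> x) = \<beta> (inv \<alpha> x)"
  by (metis alpha_beta alpha_inv_alpha inv_alpha_alpha)

lemma inv_beta_alpha: "inv \<beta> (\<alpha> x) = \<alpha> (inv \<beta> x)"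
  by (metis alpha_beta beta_inv_beta inv_beta_beta)

text \<open>The inverse of the Yau twist, which turns an associative product with commuting
  endomorphisms into a BiHom-associative one. In this locale \<open>'b\<close> is the type of
  vectors.\<close>

definition untwisted_mult :: "'b \<Rightarrow> 'b \<Rightarrow> 'b"  (infixl \<open>\<star>\<close> 70) where
  "x \<star> y = \<mu> (inv \<alpha> x) (inv \<beta> y)"

lemma untwisted_add_left: "(x + y) \<star> z = x \<star> z + y \<star> z"
  and untwisted_add_right: "z \<star> (x + y) = z \<star> x + z \<star> y"
  and untwisted_scale_left: "scale c x \<star> z = scale c (x \<star> z)"
  and untwisted_scale_right: "z \<star> scale c x = scale c (z \<star> x)"
  by (simp_all add: untwisted_mult_def inv_alpha_add inv_beta_add inv_alpha_scale inv_beta_scale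
      mult_add_left mult_add_right mult_scale_left mult_scale_right)

lemma mult_eq_untwisted: "\<mu> x y = \<alpha> x \<star> \<beta> y"
  by (simp add: untwisted_mult_def)

text \<open>\<alpha> respects \<mu> and commutes with both inverses that enter \<star>.\<close>

lemma alpha_untwisted: "\<alpha> (x \<star> y) = \<alpha> x \<star> \<alpha> y"
  by (simp add: untwisted_mult_def alpha_mult inv_beta_alpha)

lemma beta_untwisted: "\<beta> (x \<star> y) = \<beta> x \<star> \<beta> y"
  by (simp add: untwisted_mult_def beta_mult inv_alpha_beta)

lemma untwisted_assoc: "(x \<star> y) \<star> z = x \<star> (y \<star> z)"
proof -
  \<comment> \<open>Rewriting \<mu> by \<star> and pushing the twists inward gives both sides of
    BiHom-associativity the same three factors.\<close>
  have *: "(\<alpha> (\<alpha> a) \<star> \<alpha> (\<beta> b)) \<star> \<beta> (\<beta> c) = \<alpha> (\<alpha> a) \<star> (\<alpha> (\<beta> b) \<star> \<beta> (\<beta> c))" for a b c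
    using bihom_associative[of a b c]
    by (simp add: bihom_associator_def mult_eq_untwisted alpha_untwisted beta_untwisted alpha_beta)
  show ?thesis
    \<comment> \<open>By bijectivity the twisted factors are arbitrary: these preimages turn them
      into \<open>x\<close>, \<open>y\<close> and \<open>z\<close>.\<close>
    using *[of "inv \<alpha> (inv \<alpha> x)" "inv \<beta> (inv \<alpha> y)" "inv \<beta> (inv \<beta> z)"] by simp
qed

text \<open>The inverses in the second summand of \<open>plus_mult\<close> are exactly those in the
  definition of \<star>, applied to \<open>\<beta> y\<close> and \<open>\<alpha> x\<close>.\<close>

lemma plus_mult_eq_untwisted: "plus_mult \<mu> \<alpha> \<beta> x y = \<alpha> x \<star> \<beta> y + \<beta> y \<star> \<alpha> x"
  by (simp add: plus_mult_def untwisted_mult_def)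

lemma plus_mult_bihom_jordan_identity:
  "bihom_associator (plus_mult \<mu> \<alpha> \<beta>) \<alpha> \<beta>
     (plus_mult \<mu> \<alpha> \<beta> ((\<beta> ^^ 2) x) (\<alpha> (\<beta> x))) ((\<alpha> ^^ 2) (\<beta> y)) ((\<alpha> ^^ 3) x) = 0"
proof -
  define j where "j a b = a \<star> b + b \<star> a" for a b
  have plus: "plus_mult \<mu> \<alpha> \<beta> a b = j (\<alpha> a) (\<beta> b)" for a b
    by (simp add: plus_mult_eq_untwisted j_def)
  have alpha_j: "\<alpha> (j a b) = j (\<alpha> a) (\<alpha> b)" and beta_j: "\<beta> (j a b) = j (\<beta> a) (\<beta> b)" for a b
    by (simp_all add: j_def alpha_add beta_add alpha_untwisted beta_untwisted)
  have "j (j (j u u) v) u = j (j u u) (j v u)" for u v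
    by (rule jordan_identity_of_associative[where m = "(\<star>)"])
      (simp_all add: untwisted_add_left untwisted_add_right untwisted_assoc j_def)
  \<comment> \<open>The inner product becomes \<open>j w w\<close> with
    \<open>w = \<alpha> (\<beta> (\<beta> x))\<close>. Both halves of the associator apply \<alpha>
    twice more to it, so \<open>u\<close> is \<open>\<alpha> (\<alpha> w)\<close>, and
    \<open>v\<close> is the same word in \<alpha> and \<beta> applied to \<open>y\<close>.\<close>
  then show ?thesis
    by (simp add: bihom_associator_def plus alpha_j beta_j alpha_beta numeral_eq_Suc)
qed

lemma bihom_jordan_algebra_plus_mult: "bihom_jordan_algebra scale (plus_mult \<mu> \<alpha> \<beta>) \<alpha> \<beta>"
proof unfold_locales
  show "bilinear_on scale (plus_mult \<mu> \<alpha> \<beta>)"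
    by (simp add: bilinear_on_def linear_iff_add_scale plus_mult_eq_untwisted alpha_add beta_add
        alpha_scale beta_scale untwisted_add_left untwisted_add_right untwisted_scale_left
        untwisted_scale_right scale_right_distrib add_ac)
\<comment> \<open>BiHom-commutativity holds because both sides are the symmetrised \<star> product
  of \<open>\<alpha> (\<beta> x)\<close> and \<open>\<alpha> (\<beta> y)\<close>. Multiplicativity
  holds because \<alpha> and \<beta> commute and respect \<star>.\<close>
qed ((rule alpha_beta_commute plus_mult_bihom_jordan_identity |
    simp add: plus_mult_eq_untwisted alpha_add beta_add alpha_scale beta_scale
      alpha_untwisted beta_untwisted alpha_beta add_ac)+)

end

theorem proposition3p12:
  fixes scale :: "'k::{alg_closed_field, field_char_0} \<Rightarrow> 'a::ab_group_add \<Rightarrow> 'a"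
    and \<mu> :: "'a \<Rightarrow> 'a \<Rightarrow> 'a"
    and \<alpha> \<beta> :: "'a \<Rightarrow> 'a"
  assumes "bihom_associative_algebra scale \<mu> \<alpha> \<beta>"
    and "regular_bihom_algebra scale \<mu> \<alpha> \<beta>"
  shows "bihom_jordan_algebra scale (plus_mult \<mu> \<alpha> \<beta>) \<alpha> \<beta>"
proof -
  interpret regular_bihom_associative_algebra scale \<mu> \<alpha> \<beta>
    using assms by (rule regular_bihom_associative_algebra.intro)
  show ?thesis
    by (rule bihom_jordan_algebra_plus_mult)
qed

end
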